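(* Let $A, B \in \mathcal{K}^d_{kc}$, let $R : \mathcal{K}^d_{kc} \to [0, \infty)$ be a strictly convex, lower semicontinuous functional, and let $\gamma > 0$. Then the perturbed problem $$\min_{X \in \mathcal{K}^d_{kc}} \left[ d_H(A, B \oplus X) + \gamma R(X) \right]$$ has a unique solution, i.e. there is exactly one $X\in\mathcal{K}^d_{kc}$ attaining the minimum.
   Context: $\mathcal{K}^d_{kc}$ is the set of all nonempty compact convex subsets of Euclidean space $\mathbb{R}^d$ (with norm $\|\cdot\|$). Minkowski sum: $A\oplus B=\{a+b: a\in A, b\in B\}$; $\lambda A=\{\lambda a: a\in A\}$. Hausdorff distance: $d_H(A,B)=\max\{\sup_{a\in A}\inf_{b\in B}\|a-b\|,\ \sup_{b\in B}\inf_{a\in A}\|a-b\|\}$. $R$ is strictly convex if $R(\lambda X_1\oplus(1-\lambda)X_2)<\lambda R(X_1)+(1-\lambda)R(X_2)$ for all $X_1\neq X_2$ in $\mathcal{K}^d_{kc}$ and $\lambda\in(0,1)$. Lower semicontinuity is with respect to $d_H$. *)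

theory Defs
  imports "HOL-Analysis.Analysis"
begin

definition compact_convex_sets :: "'a::euclidean_space set set"
  where "compact_convex_sets = {X. X \<noteq> {} \<and> compact X \<and> convex X}"

text \<open>Meaningful for nonempty bounded sets only: otherwise the suprema may be unspecified.\<close>

definition hausdorff_distance :: "'a::metric_space set \<Rightarrow> 'a set \<Rightarrow> real"
  where "hausdorff_distance A B = max (SUP a\<in>A. infdist a B) (SUP b\<in>B. infdist b A)"

text \<open>
  A functional on \<^const>\<open>compact_convex_sets\<close> is represented by a function on all sets;
  its values elsewhere are irrelevant. Minkowski addition is \<^const>\<open>plus\<close> on sets, from
  \<^theory>\<open>HOL-Library.Set_Algebras\<close>.
\<close>

definition strictly_convex_functional :: "('a::euclidean_space set \<Rightarrow> real) \<Rightarrow> bool"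
  where "strictly_convex_functional R \<longleftrightarrow>
    (\<forall>X\<in>compact_convex_sets. \<forall>Y\<in>compact_convex_sets. \<forall>t. X \<noteq> Y \<longrightarrow> 0 < t \<longrightarrow> t < 1 \<longrightarrow>
      R ((*\<^sub>R) t ` X + (*\<^sub>R) (1 - t) ` Y) < t * R X + (1 - t) * R Y)"

definition lower_semicontinuous_functional :: "('a::euclidean_space set \<Rightarrow> real) \<Rightarrow> bool"
  where "lower_semicontinuous_functional R \<longleftrightarrow>
    (\<forall>X\<in>compact_convex_sets. \<forall>e>0. \<exists>d>0. \<forall>Y\<in>compact_convex_sets.
      hausdorff_distance Y X < d \<longrightarrow> R X - e < R Y)"

end

theory Submission
  imports Defs "HOL-Complex_Analysis.Great_Picard"
begin

text \<open>
  Existence is the direct method. Replacing \<open>X\<close> by \<open>Y\<close> changes \<open>d\<^sub>H(A, B \<oplus> X)\<close> by at most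
  \<open>d\<^sub>H(X, Y)\<close>, so the objective is lower semicontinuous. Along a minimizing sequence
  \<open>d\<^sub>H(A, B \<oplus> X)\<close> is bounded because \<open>\<gamma> R \<ge> 0\<close>, and as \<open>A\<close> and \<open>B\<close> are bounded this confines the
  whole sequence to one ball. The Blaschke selection theorem
  (\<open>Blaschke_selection\<close>) then extracts a convergent subsequence, whose limit is a minimizer.

  Uniqueness is strict convexity. Since \<open>A\<close> and \<open>B\<close> are convex, \<open>X \<mapsto> d\<^sub>H(A, B \<oplus> X)\<close> is convex for
  Minkowski combinations (\<open>hausdorff_distance_Minkowski_convex\<close> together with
  \<open>convex_plus_Minkowski_combination\<close>), and adding the strictly
  convex \<open>\<gamma> R\<close> makes the objective strictly convex: the midpoint of two distinct minimizers would be
  strictly better than both.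
\<close>

section \<open>The Hausdorff distance of compact sets\<close>

lemma infdist_le_iff_compact:
  fixes S :: "'a::heine_borel set"
  assumes "compact S" "S \<noteq> {}"
  shows "infdist x S \<le> e \<longleftrightarrow> (\<exists>s\<in>S. dist x s \<le> e)"
proof
  assume "infdist x S \<le> e"
  moreover obtain s where "s \<in> S" "infdist x S = dist x s"
    using infdist_attains_inf[of S x] assms compact_imp_closed by blast
  ultimately show "\<exists>s\<in>S. dist x s \<le> e" by auto
qed (auto intro: infdist_le2)

text \<open>
  All later estimates go through this description, which replaces suprema and infima by the choice
  of nearby points; compactness is what makes the nearest point exist.
\<close>

lemma hausdorff_distance_le_iff:
  fixes S T :: "'a::heine_borel set"
  assumes "compact S" "S \<noteq> {}" "compact T" "T \<noteq> {}"
  shows "hausdorff_distance S T \<le> e \<longleftrightarrow>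
    (\<forall>s\<in>S. \<exists>t\<in>T. dist s t \<le> e) \<and> (\<forall>t\<in>T. \<exists>s\<in>S. dist t s \<le> e)"
proof -
  have bdd: "bdd_above ((\<lambda>u. infdist u V) ` U)" if "compact U" for U V :: "'a set"
    using that
    by (intro bounded_imp_bdd_above compact_imp_bounded compact_continuous_image continuous_intros)
  show ?thesis
    unfolding hausdorff_distance_def max.bounded_iff
    using assms by (simp add: cSUP_le_iff bdd infdist_le_iff_compact)
qed

lemma hausdorff_distance_nonneg:
  fixes S T :: "'a::heine_borel set"
  assumes "compact S" "S \<noteq> {}" "compact T" "T \<noteq> {}"
  shows "0 \<le> hausdorff_distance S T"
  using hausdorff_distance_le_iff[OF assms, of "hausdorff_distance S T"] \<open>S \<noteq> {}\<close>
  by (meson all_not_in_conv order_refl order_trans zero_le_dist)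

lemma hausdorff_distance_nearby:
  fixes S T :: "'a::heine_borel set"
  assumes "compact S" "S \<noteq> {}" "compact T" "T \<noteq> {}"
  shows "s \<in> S \<Longrightarrow> \<exists>t\<in>T. dist s t \<le> hausdorff_distance S T"
    and "t \<in> T \<Longrightarrow> \<exists>s\<in>S. dist t s \<le> hausdorff_distance S T"
  using hausdorff_distance_le_iff[OF assms, of "hausdorff_distance S T"] by auto

lemma compact_set_plus:
  fixes S T :: "'a::real_normed_vector set"
  assumes "compact S" "compact T"
  shows "compact (S + T)"
proof -
  have "S + T = {x + y | x y. x \<in> S \<and> y \<in> T}" by (auto simp: set_plus_def)
  with compact_sums[OF assms] show ?thesis by metis
qed

lemma set_plus_nonempty: "S \<noteq> {} \<Longrightarrow> T \<noteq> {} \<Longrightarrow> S + T \<noteq> {}"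
  by (auto simp: set_plus_def)

lemma hausdorff_distance_plus_triangle:
  fixes A B X Y :: "'a::euclidean_space set"
  assumes "compact A" "A \<noteq> {}" "compact B" "B \<noteq> {}" "compact X" "X \<noteq> {}" "compact Y" "Y \<noteq> {}"
  shows "hausdorff_distance A (B + X) \<le> hausdorff_distance A (B + Y) + hausdorff_distance Y X"
proof -
  have BX: "compact (B + X)" "B + X \<noteq> {}" and BY: "compact (B + Y)" "B + Y \<noteq> {}"
    using assms by (simp_all add: compact_set_plus set_plus_nonempty)
  note AY = hausdorff_distance_nearby[OF assms(1,2) BY]
  note YX = hausdorff_distance_nearby[OF assms(7,8,5,6)]
  show ?thesis
    unfolding hausdorff_distance_le_iff[OF assms(1,2) BX]
  proof (intro conjI ballI)
    fix a assume "a \<in> A"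
    then obtain b y where b: "b \<in> B" "y \<in> Y" "dist a (b + y) \<le> hausdorff_distance A (B + Y)"
      using AY(1) by (metis set_plus_elim)
    obtain x where x: "x \<in> X" "dist y x \<le> hausdorff_distance Y X"
      using YX(1) \<open>y \<in> Y\<close> by blast
    have "dist a (b + x) \<le> dist a (b + y) + dist y x"
      using dist_triangle[of a "b + x" "b + y"] by simp
    then show "\<exists>z\<in>B + X. dist a z \<le> hausdorff_distance A (B + Y) + hausdorff_distance Y X"
      using b x by (intro bexI[of _ "b + x"]) auto
  next
    fix z assume "z \<in> B + X"
    then obtain b x where z: "z = b + x" "b \<in> B" "x \<in> X"
      by (metis set_plus_elim)
    obtain y where y: "y \<in> Y" "dist x y \<le> hausdorff_distance Y X"
      using YX(2) z by blast
    obtain a where a: "a \<in> A" "dist (b + y) a \<le> hausdorff_distance A (B + Y)"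
      using AY(2) z y by blast
    have "dist z a \<le> dist x y + dist (b + y) a"
      using dist_triangle[of z a "b + y"] z by simp
    then show "\<exists>a\<in>A. dist z a \<le> hausdorff_distance A (B + Y) + hausdorff_distance Y X"
      using a y by (intro bexI[of _ a]) auto
  qed
qed

section \<open>Convexity under Minkowski combinations\<close>

text \<open>
  Convexity of \<open>B\<close> serves the inclusion \<open>\<supseteq>\<close>, where two independent points of \<open>B\<close> have to be
  merged into one.
\<close>

lemma convex_plus_Minkowski_combination:
  fixes B X Y :: "'a::real_vector set"
  assumes "convex B" "0 \<le> t" "t \<le> 1"
  shows "B + ((*\<^sub>R) t ` X + (*\<^sub>R) (1 - t) ` Y) = (*\<^sub>R) t ` (B + X) + (*\<^sub>R) (1 - t) ` (B + Y)"
proof (intro equalityI subsetI)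
  fix z assume "z \<in> B + ((*\<^sub>R) t ` X + (*\<^sub>R) (1 - t) ` Y)"
  then obtain b x y where z: "z = b + (t *\<^sub>R x + (1 - t) *\<^sub>R y)" "b \<in> B" "x \<in> X" "y \<in> Y"
    by (auto simp: set_plus_def)
  then have "z = t *\<^sub>R (b + x) + (1 - t) *\<^sub>R (b + y)"
    by (simp add: algebra_simps)
  then show "z \<in> (*\<^sub>R) t ` (B + X) + (*\<^sub>R) (1 - t) ` (B + Y)"
    using z by blast
next
  fix z assume "z \<in> (*\<^sub>R) t ` (B + X) + (*\<^sub>R) (1 - t) ` (B + Y)"
  then obtain b c x y where z: "z = t *\<^sub>R (b + x) + (1 - t) *\<^sub>R (c + y)"
    "b \<in> B" "c \<in> B" "x \<in> X" "y \<in> Y"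
    by (auto simp: set_plus_def)
  then have "z = (t *\<^sub>R b + (1 - t) *\<^sub>R c) + (t *\<^sub>R x + (1 - t) *\<^sub>R y)"
    by (simp add: algebra_simps)
  moreover have "t *\<^sub>R b + (1 - t) *\<^sub>R c \<in> B"
    using assms z by (intro convexD) auto
  ultimately show "z \<in> B + ((*\<^sub>R) t ` X + (*\<^sub>R) (1 - t) ` Y)"
    using z by blast
qed

lemma compact_convex_sets_Minkowski_combination:
  assumes "X \<in> compact_convex_sets" "Y \<in> compact_convex_sets"
  shows "(*\<^sub>R) t ` X + (*\<^sub>R) (1 - t) ` Y \<in> compact_convex_sets"
  using assms unfolding compact_convex_sets_def
  by (simp add: compact_set_plus compact_scaling convex_set_plus convex_scaling set_plus_nonempty)

lemma dist_convex_combination_le: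
  fixes a b c d :: "'a::real_normed_vector"
  assumes "0 \<le> t" "t \<le> 1" "dist a c \<le> p" "dist b d \<le> q"
  shows "dist (t *\<^sub>R a + (1 - t) *\<^sub>R b) (t *\<^sub>R c + (1 - t) *\<^sub>R d) \<le> t * p + (1 - t) * q"
proof -
  have "dist (t *\<^sub>R a + (1 - t) *\<^sub>R b) (t *\<^sub>R c + (1 - t) *\<^sub>R d)
      \<le> dist (t *\<^sub>R a) (t *\<^sub>R c) + dist ((1 - t) *\<^sub>R b) ((1 - t) *\<^sub>R d)"
    by (rule dist_triangle_add)
  also have "\<dots> = t * dist a c + (1 - t) * dist b d"
    using assms(1,2) by (simp add: dist_norm flip: scaleR_diff_right)
  also have "\<dots> \<le> t * p + (1 - t) * q"
    using assms by (intro add_mono mult_left_mono) auto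
  finally show ?thesis .
qed

text \<open>
  Nearby points can be combined with the same weights on both sides; convexity of \<open>A\<close> brings the
  combination of two points of \<open>A\<close> back into \<open>A\<close>.
\<close>

lemma hausdorff_distance_Minkowski_convex:
  fixes A C D :: "'a::euclidean_space set"
  assumes A: "compact A" "A \<noteq> {}" "convex A"
    and C: "compact C" "C \<noteq> {}" and D: "compact D" "D \<noteq> {}"
    and t: "0 \<le> t" "t \<le> 1"
  shows "hausdorff_distance A ((*\<^sub>R) t ` C + (*\<^sub>R) (1 - t) ` D)
    \<le> t * hausdorff_distance A C + (1 - t) * hausdorff_distance A D" (is "_ \<le> ?e")
proof -
  let ?M = "(*\<^sub>R) t ` C + (*\<^sub>R) (1 - t) ` D"
  have M: "compact ?M" "?M \<noteq> {}"
    using C D by (simp_all add: compact_set_plus compact_scaling set_plus_nonempty)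
  note AC = hausdorff_distance_nearby[OF A(1,2) C]
  note AD = hausdorff_distance_nearby[OF A(1,2) D]
  show ?thesis
    unfolding hausdorff_distance_le_iff[OF A(1,2) M]
  proof (intro conjI ballI)
    fix a assume a: "a \<in> A"
    obtain c where c: "c \<in> C" "dist a c \<le> hausdorff_distance A C"
      using AC(1)[OF a] by blast
    obtain d where d: "d \<in> D" "dist a d \<le> hausdorff_distance A D"
      using AD(1)[OF a] by blast
    have "dist (t *\<^sub>R a + (1 - t) *\<^sub>R a) (t *\<^sub>R c + (1 - t) *\<^sub>R d) \<le> ?e"
      by (rule dist_convex_combination_le[OF t c(2) d(2)])
    moreover have "t *\<^sub>R a + (1 - t) *\<^sub>R a = a"
      by (simp flip: scaleR_left_distrib)
    ultimately show "\<exists>m\<in>?M. dist a m \<le> ?e"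
      using c d by (intro bexI[of _ "t *\<^sub>R c + (1 - t) *\<^sub>R d"]) auto
  next
    fix m assume "m \<in> ?M"
    then obtain c d where m: "m = t *\<^sub>R c + (1 - t) *\<^sub>R d" "c \<in> C" "d \<in> D"
      by (auto simp: set_plus_def)
    obtain a where a: "a \<in> A" "dist c a \<le> hausdorff_distance A C"
      using AC(2) m by blast
    obtain b where b: "b \<in> A" "dist d b \<le> hausdorff_distance A D"
      using AD(2) m by blast
    have "dist m (t *\<^sub>R a + (1 - t) *\<^sub>R b) \<le> ?e"
      unfolding m(1) by (rule dist_convex_combination_le[OF t a(2) b(2)])
    moreover have "t *\<^sub>R a + (1 - t) *\<^sub>R b \<in> A"
      using A(3) a b t by (intro convexD) auto
    ultimately show "\<exists>a\<in>A. dist m a \<le> ?e"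
      by blast
  qed
qed

section \<open>Blaschke selection\<close>

lemma infdist_convex_combination_le:
  fixes S :: "'a::euclidean_space set"
  assumes S: "compact S" "S \<noteq> {}" "convex S" and t: "0 \<le> t" "t \<le> 1"
  shows "infdist (t *\<^sub>R x + (1 - t) *\<^sub>R y) S \<le> t * infdist x S + (1 - t) * infdist y S"
proof -
  obtain p where p: "p \<in> S" "dist x p \<le> infdist x S"
    using infdist_le_iff_compact[OF S(1,2), of x] by blast
  obtain q where q: "q \<in> S" "dist y q \<le> infdist y S"
    using infdist_le_iff_compact[OF S(1,2), of y] by blast
  have "t *\<^sub>R p + (1 - t) *\<^sub>R q \<in> S"
    using S(3) p q t by (intro convexD) auto
  then show ?thesis
    using dist_convex_combination_le[OF t p(2) q(2)] by (rule infdist_le2)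
qed

text \<open>
  The distance functions \<open>infdist _ (X n)\<close> are 1-Lipschitz and uniformly bounded on the ball, so by
  Arzela--Ascoli a subsequence converges uniformly to some \<open>f\<close>. The limit set is the zero set
  of \<open>f\<close>. It is convex because \<open>f\<close> inherits convexity from the distance functions. It is
  nonempty because \<open>f\<close> attains its minimum over the ball, and that minimum is at most \<open>f x\<close> for
  any \<open>x\<close> in \<open>X (k n)\<close>, where the \<open>n\<close>-th distance function vanishes and \<open>f\<close> is therefore
  uniformly small.
\<close>

theorem Blaschke_selection:
  fixes X :: "nat \<Rightarrow> 'a::euclidean_space set"
  assumes X: "\<And>n. X n \<in> compact_convex_sets" and sub: "\<And>n. X n \<subseteq> cball 0 r"
  obtains L k where "L \<in> compact_convex_sets" "strict_mono (k :: nat \<Rightarrow> nat)"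
    "(\<lambda>n. hausdorff_distance (X (k n)) L) \<longlonglongrightarrow> 0"
proof -
  define K :: "'a set" where "K = cball 0 r"
  have K: "compact K" "convex K" by (auto simp: K_def)
  have XK: "x \<in> K" if "x \<in> X n" for x n
    using sub that unfolding K_def by blast
  have Xc: "compact (X n)" "X n \<noteq> {}" "convex (X n)" for n
    using X[of n] by (auto simp: compact_convex_sets_def)
  have bound: "norm (infdist x (X n)) \<le> 2 * r" if "x \<in> K" for n x
  proof -
    obtain y where y: "y \<in> X n" using Xc by blast
    have "norm x \<le> r" "norm y \<le> r"
      using that XK[OF y] by (auto simp: K_def)
    then have "dist x y \<le> 2 * r"
      using norm_triangle_ineq4[of x y] by (simp add: dist_norm)
    with y have "infdist x (X n) \<le> 2 * r" by (rule infdist_le2)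
    then show ?thesis by (simp add: infdist_nonneg)
  qed
  have equi: "\<exists>d>0. \<forall>n y. y \<in> K \<and> norm (x - y) < d \<longrightarrow>
      norm (infdist x (X n) - infdist y (X n)) < e" if "0 < e" for x e
    using that infdist_triangle_abs[of x _ y for y]
    by (intro exI[of _ e]) (auto simp: dist_norm intro: le_less_trans)
  obtain f and k :: "nat \<Rightarrow> nat" where f: "continuous_on K f" and k: "strict_mono k"
    and conv: "\<And>e. 0 < e \<Longrightarrow> \<exists>N. \<forall>n x. n \<ge> N \<and> x \<in> K \<longrightarrow> norm (infdist x (X (k n)) - f x) < e"
    using Arzela_Ascoli[OF K(1), of "\<lambda>n x. infdist x (X n)" "2 * r"] bound equi by blast
  have lim: "(\<lambda>n. infdist x (X (k n))) \<longlonglongrightarrow> f x" if "x \<in> K" for x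
    unfolding LIMSEQ_iff using conv that by meson
  have nonneg: "0 \<le> f x" if "x \<in> K" for x
    using lim[OF that] by (rule LIMSEQ_le_const) (auto simp: infdist_nonneg)
  define L where "L = {x \<in> K. f x = 0}"
  have "compact L"
  proof -
    have "closed (K \<inter> f -` {0})"
      using f K by (intro continuous_closed_preimage compact_imp_closed) auto
    moreover have "L = K \<inter> (K \<inter> f -` {0})" by (auto simp: L_def)
    ultimately show ?thesis using K(1) by (metis compact_Int_closed)
  qed
  have small: "\<exists>N. \<forall>n\<ge>N. \<forall>x\<in>X (k n). f x < e" if e: "0 < e" for e
  proof -
    obtain N where N: "\<And>n x. n \<ge> N \<Longrightarrow> x \<in> K \<Longrightarrow> norm (infdist x (X (k n)) - f x) < e"
      using conv[OF e] by blast
    have "f x < e" if "n \<ge> N" "x \<in> X (k n)" for n x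
      using N[OF that(1) XK[OF that(2)]] that nonneg[OF XK[OF that(2)]] by simp
    then show ?thesis by blast
  qed
  have "L \<noteq> {}"
  proof -
    have "K \<noteq> {}" using Xc(2)[of 0] XK by blast
    then obtain z where z: "z \<in> K" "\<And>y. y \<in> K \<Longrightarrow> f z \<le> f y"
      using continuous_attains_inf[OF K(1) _ f] by blast
    have "f z < e" if e: "0 < e" for e
    proof -
      obtain N where "\<forall>x\<in>X (k N). f x < e" using small[OF e] by blast
      moreover obtain x where "x \<in> X (k N)" using Xc(2) by blast
      ultimately show ?thesis using z(2)[OF XK] by fastforce
    qed
    then have "f z \<le> 0" by (meson less_irrefl not_le_imp_less)
    then show ?thesis using z(1) nonneg[OF z(1)] by (auto simp: L_def)
  qed
  have "convex L"
    unfolding convex_alt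
  proof (intro ballI allI impI)
    fix x y u assume xy: "x \<in> L" "y \<in> L" and u: "0 \<le> u \<and> u \<le> (1::real)"
    let ?z = "(1 - u) *\<^sub>R x + u *\<^sub>R y"
    have xK: "x \<in> K" "y \<in> K" using xy by (auto simp: L_def)
    then have zK: "?z \<in> K" using K(2) u by (auto simp: convex_alt)
    have "f ?z \<le> (1 - u) * f x + u * f y"
    proof (rule LIMSEQ_le[OF lim[OF zK]])
      show "(\<lambda>n. (1 - u) * infdist x (X (k n)) + u * infdist y (X (k n)))
          \<longlonglongrightarrow> (1 - u) * f x + u * f y"
        by (intro tendsto_intros lim xK)
      show "\<exists>N. \<forall>n\<ge>N. infdist ?z (X (k n)) \<le>
          (1 - u) * infdist x (X (k n)) + u * infdist y (X (k n))"
        using infdist_convex_combination_le[OF Xc, of "1 - u" x y] u by simp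
    qed
    then have "f ?z \<le> 0" using xy by (simp add: L_def)
    then show "?z \<in> L" using zK nonneg[OF zK] by (simp add: L_def)
  qed
  have L: "L \<in> compact_convex_sets"
    using \<open>compact L\<close> \<open>L \<noteq> {}\<close> \<open>convex L\<close> by (simp add: compact_convex_sets_def)
  have close: "\<exists>N. \<forall>n\<ge>N. hausdorff_distance (X (k n)) L \<le> e" if e: "0 < e" for e
  proof -
    obtain N1 where N1: "\<And>n x. n \<ge> N1 \<Longrightarrow> x \<in> K \<Longrightarrow> norm (infdist x (X (k n)) - f x) < e"
      using conv[OF e] by blast
    \<comment> \<open>On the compact set of points at distance at least \<open>e\<close> from \<open>L\<close>, the function \<open>f\<close> is bounded
      away from 0, so \<open>X (k n)\<close> cannot meet that set once \<open>f\<close> is small on it.\<close>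
    define F where "F = K \<inter> {x. e \<le> infdist x L}"
    have "closed {x. e \<le> infdist x L}"
      by (intro closed_Collect_le continuous_intros)
    then have F: "compact F" unfolding F_def using K(1) by (rule compact_Int_closed[rotated])
    have "\<exists>\<delta>>0. \<forall>x\<in>F. \<delta> \<le> f x"
    proof (cases "F = {}")
      case False
      have "continuous_on F f" using f by (rule continuous_on_subset) (auto simp: F_def)
      then obtain z where z: "z \<in> F" "\<forall>x\<in>F. f z \<le> f x"
        using continuous_attains_inf[OF F False] by blast
      have "f z \<noteq> 0"
      proof
        assume "f z = 0"
        then have "z \<in> L" using z(1) by (simp add: L_def F_def)
        then show False using z(1) e by (simp add: F_def)
      qed
      then have "0 < f z" using nonneg[of z] z(1) by (auto simp: F_def)
      then show ?thesis using z(2) by blast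
    qed (auto intro: exI[of _ 1])
    then obtain \<delta> where \<delta>: "\<delta> > 0" "\<And>x. x \<in> F \<Longrightarrow> \<delta> \<le> f x" by blast
    obtain N2 where N2: "\<And>n x. n \<ge> N2 \<Longrightarrow> x \<in> X (k n) \<Longrightarrow> f x < \<delta>"
      using small[OF \<delta>(1)] by blast
    have "hausdorff_distance (X (k n)) L \<le> e" if n: "n \<ge> max N1 N2" for n
      unfolding hausdorff_distance_le_iff[OF Xc(1,2) \<open>compact L\<close> \<open>L \<noteq> {}\<close>]
    proof (intro conjI ballI)
      fix x assume x: "x \<in> X (k n)"
      then have "x \<notin> F" using N2[of n x] \<delta>(2)[of x] n by force
      then have "infdist x L \<le> e" using XK[OF x] by (simp add: F_def)
      then show "\<exists>l\<in>L. dist x l \<le> e"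
        using infdist_le_iff_compact[OF \<open>compact L\<close> \<open>L \<noteq> {}\<close>] by blast
    next
      fix l assume "l \<in> L"
      then have "infdist l (X (k n)) \<le> e" using N1[of n l] n by (simp add: L_def)
      then show "\<exists>x\<in>X (k n). dist l x \<le> e"
        using infdist_le_iff_compact[OF Xc(1,2)] by blast
    qed
    then show ?thesis by blast
  qed
  have "(\<lambda>n. hausdorff_distance (X (k n)) L) \<longlonglongrightarrow> 0"
  proof (rule LIMSEQ_I)
    fix e :: real assume "0 < e"
    then obtain N where N: "\<And>n. n \<ge> N \<Longrightarrow> hausdorff_distance (X (k n)) L \<le> e / 2"
      using close[of "e / 2"] by auto
    have "norm (hausdorff_distance (X (k n)) L - 0) < e" if "n \<ge> N" for n
      using N[OF that] \<open>0 < e\<close>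
        hausdorff_distance_nonneg[OF Xc(1,2) \<open>compact L\<close> \<open>L \<noteq> {}\<close>, of "k n"] by simp
    then show "\<exists>N. \<forall>n\<ge>N. norm (hausdorff_distance (X (k n)) L - 0) < e" by blast
  qed
  then show thesis using that L k by blast
qed

section \<open>Existence and uniqueness of the minimizer\<close>

text \<open>This is the coercivity that makes selection applicable to minimizing sequences.\<close>

lemma bounded_hausdorff_distance_plus_sublevel:
  fixes A B :: "'a::euclidean_space set"
  assumes A: "compact A" "A \<noteq> {}" and B: "compact B" "B \<noteq> {}"
  obtains r where "\<And>X. compact X \<Longrightarrow> X \<noteq> {} \<Longrightarrow> hausdorff_distance A (B + X) \<le> c \<Longrightarrow> X \<subseteq> cball 0 r"
proof -
  obtain \<alpha> where \<alpha>: "\<And>a. a \<in> A \<Longrightarrow> norm a \<le> \<alpha>"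
    using compact_imp_bounded[OF A(1)] by (auto simp: bounded_iff)
  obtain b where b: "b \<in> B" using B(2) by blast
  have "X \<subseteq> cball 0 (\<alpha> + norm b + c)"
    if X: "compact X" "X \<noteq> {}" and le: "hausdorff_distance A (B + X) \<le> c" for X
  proof
    fix x assume x: "x \<in> X"
    have BX: "compact (B + X)" "B + X \<noteq> {}"
      using B X by (simp_all add: compact_set_plus set_plus_nonempty)
    have "b + x \<in> B + X" using b x by blast
    then obtain a where a: "a \<in> A" "dist (b + x) a \<le> c"
      using le hausdorff_distance_le_iff[OF A BX] by blast
    have "x = ((b + x) - a) + (a - b)" by simp
    then have "norm x \<le> norm ((b + x) - a) + norm (a - b)" by (metis norm_triangle_ineq)
    also have "\<dots> \<le> c + (\<alpha> + norm b)"
      using a \<alpha>[OF a(1)] norm_triangle_ineq4[of a b] by (simp add: dist_norm)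
    finally show "x \<in> cball 0 (\<alpha> + norm b + c)" by simp
  qed
  then show thesis by (rule that)
qed

theorem proposition9:
  fixes A B :: "'a::euclidean_space set" and R :: "'a set \<Rightarrow> real" and \<gamma> :: real
  assumes "A \<in> compact_convex_sets" and "B \<in> compact_convex_sets"
    and "\<And>X. X \<in> compact_convex_sets \<Longrightarrow> 0 \<le> R X"
    and "strictly_convex_functional R"
    and "lower_semicontinuous_functional R"
    and "\<gamma> > 0"
  shows "\<exists>!X. is_arg_min (\<lambda>X. hausdorff_distance A (B + X) + \<gamma> * R X)
                 (\<lambda>X. X \<in> compact_convex_sets) X"
proof -
  define F where "F = (\<lambda>X. hausdorff_distance A (B + X) + \<gamma> * R X)"
  have A: "compact A" "A \<noteq> {}" "convex A" and B: "compact B" "B \<noteq> {}" "convex B"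
    using assms(1,2) by (auto simp: compact_convex_sets_def)
  have cc: "compact X" "X \<noteq> {}" if "X \<in> compact_convex_sets" for X :: "'a set"
    using that by (auto simp: compact_convex_sets_def)
  have BX: "compact (B + X)" "B + X \<noteq> {}" if "X \<in> compact_convex_sets" for X
    using B cc[OF that] by (simp_all add: compact_set_plus set_plus_nonempty)
  have hF: "hausdorff_distance A (B + X) \<le> F X" if "X \<in> compact_convex_sets" for X
    using assms(3)[OF that] assms(6) by (simp add: F_def)
  have F_nonneg: "0 \<le> F X" if "X \<in> compact_convex_sets" for X
    using hF[OF that] hausdorff_distance_nonneg[OF A(1,2) BX[OF that]] by linarith

  have strict: "F ((*\<^sub>R) (1/2) ` X + (*\<^sub>R) (1/2) ` Y) < (F X + F Y) / 2"
    if XY: "X \<in> compact_convex_sets" "Y \<in> compact_convex_sets" "X \<noteq> Y" for X Y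
  proof -
    let ?M = "(*\<^sub>R) (1/2) ` X + (*\<^sub>R) (1/2) ` Y"
    have "R ?M < 1/2 * R X + (1 - 1/2) * R Y"
      using assms(4)[unfolded strictly_convex_functional_def, rule_format, OF XY, of "1/2"] by simp
    then have "\<gamma> * R ?M < \<gamma> * (1/2 * R X + (1 - 1/2) * R Y)"
      using assms(6) by (rule mult_strict_left_mono)
    moreover have "hausdorff_distance A (B + ?M)
        \<le> 1/2 * hausdorff_distance A (B + X) + 1/2 * hausdorff_distance A (B + Y)"
      using hausdorff_distance_Minkowski_convex[OF A BX[OF XY(1)] BX[OF XY(2)], of "1/2"]
        convex_plus_Minkowski_combination[OF B(3), of "1/2" X Y] by simp
    ultimately show ?thesis by (simp add: F_def field_simps)
  qed

  define m where "m = Inf (F ` compact_convex_sets)"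
  have bdd: "bdd_below (F ` compact_convex_sets)"
    using F_nonneg by (intro bdd_belowI[of _ 0]) auto
  have m_le: "m \<le> F X" if "X \<in> compact_convex_sets" for X
    unfolding m_def using bdd that by (intro cINF_lower)
  have "F ` compact_convex_sets \<noteq> {}"
    using assms(1) by blast
  then have "\<exists>X\<in>compact_convex_sets. F X < m + 1 / Suc n" for n
    using cInf_lessD[of "F ` compact_convex_sets" "m + 1 / Suc n"] by (auto simp: m_def)
  then obtain X where X: "\<And>n. X n \<in> compact_convex_sets" and Xm: "\<And>n. F (X n) < m + 1 / Suc n"
    by metis
  obtain r where r: "\<And>Y. compact Y \<Longrightarrow> Y \<noteq> {} \<Longrightarrow> hausdorff_distance A (B + Y) \<le> m + 1 \<Longrightarrow> Y \<subseteq> cball 0 r"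
    using bounded_hausdorff_distance_plus_sublevel[OF A(1,2) B(1,2), of "m + 1"] by blast
  have "X n \<subseteq> cball 0 r" for n
  proof (rule r[OF cc[OF X]])
    have "1 / real (Suc n) \<le> 1" by simp
    then show "hausdorff_distance A (B + X n) \<le> m + 1"
      using hF[OF X] Xm[of n] by (meson add_left_mono less_imp_le order_trans)
  qed
  then obtain L k where L: "L \<in> compact_convex_sets" and k: "strict_mono (k :: nat \<Rightarrow> nat)"
    and lim: "(\<lambda>n. hausdorff_distance (X (k n)) L) \<longlonglongrightarrow> 0"
    by (rule Blaschke_selection[OF X])

  have "F L \<le> m"
  proof (rule field_le_epsilon)
    fix e :: real assume e: "0 < e"
    \<comment> \<open>The error \<open>e\<close> is split into thirds: for \<open>\<gamma> R\<close>, for the Hausdorff distance to \<open>L\<close>, and for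
      the minimizing sequence.\<close>
    define \<epsilon> where "\<epsilon> = e / (3 * \<gamma>)"
    have "\<epsilon> > 0" using e assms(6) by (simp add: \<epsilon>_def)
    then obtain d where d: "d > 0"
      "\<And>Y. Y \<in> compact_convex_sets \<Longrightarrow> hausdorff_distance Y L < d \<Longrightarrow> R L - \<epsilon> < R Y"
      using assms(5) L unfolding lower_semicontinuous_functional_def by meson
    have "\<forall>\<^sub>F n in sequentially. hausdorff_distance (X (k n)) L < min d (e / 3)"
      using lim d(1) e by (intro order_tendstoD(2)) auto
    moreover have "\<forall>\<^sub>F n in sequentially. 1 / real (Suc (k n)) < e / 3"
    proof -
      have "(\<lambda>n. 1 / real (Suc n)) \<longlonglongrightarrow> 0"
        using LIMSEQ_inverse_real_of_nat by (simp add: inverse_eq_divide)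
      then have "(\<lambda>n. 1 / real (Suc (k n))) \<longlonglongrightarrow> 0"
        using LIMSEQ_subseq_LIMSEQ[OF _ k] by (force simp: o_def)
      then show ?thesis using e by (intro order_tendstoD(2)) auto
    qed
    ultimately have "\<forall>\<^sub>F n in sequentially. hausdorff_distance (X (k n)) L < min d (e / 3) \<and>
        1 / real (Suc (k n)) < e / 3"
      by (rule eventually_conj)
    then obtain n where n: "hausdorff_distance (X (k n)) L < d"
      "hausdorff_distance (X (k n)) L < e / 3" "1 / real (Suc (k n)) < e / 3"
      unfolding eventually_sequentially by auto
    have "\<gamma> * (R L - \<epsilon>) \<le> \<gamma> * R (X (k n))"
      using d(2)[OF X n(1)] assms(6) by (intro mult_left_mono) auto
    then have "\<gamma> * R L \<le> \<gamma> * R (X (k n)) + e / 3"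
      using assms(6) by (simp add: \<epsilon>_def algebra_simps)
    moreover have "hausdorff_distance A (B + L)
        \<le> hausdorff_distance A (B + X (k n)) + hausdorff_distance (X (k n)) L"
      using hausdorff_distance_plus_triangle[OF A(1,2) B(1,2) cc[OF L] cc[OF X]] .
    ultimately have "F L \<le> F (X (k n)) + 2 * (e / 3)"
      using n(2) by (simp add: F_def)
    also have "F (X (k n)) < m + e / 3"
      using Xm[of "k n"] n(3) by linarith
    finally show "F L \<le> m + e" by simp
  qed
  then have min: "is_arg_min F (\<lambda>X. X \<in> compact_convex_sets) L"
    using L m_le unfolding is_arg_min_def by (metis leD order_trans)

  have "Y = Z" if Y: "is_arg_min F (\<lambda>X. X \<in> compact_convex_sets) Y"
    and Z: "is_arg_min F (\<lambda>X. X \<in> compact_convex_sets) Z" for Y Z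
  proof (rule ccontr)
    assume "Y \<noteq> Z"
    have mem: "Y \<in> compact_convex_sets" "Z \<in> compact_convex_sets"
      using Y Z by (auto simp: is_arg_min_def)
    define M where "M = (*\<^sub>R) (1/2) ` Y + (*\<^sub>R) (1/2) ` Z"
    have M: "M \<in> compact_convex_sets"
      using compact_convex_sets_Minkowski_combination[OF mem, of "1/2"] by (simp add: M_def)
    have "F Y \<le> F M" "F Z \<le> F M"
      using Y Z M by (auto simp: is_arg_min_def not_less)
    moreover have "F M < (F Y + F Z) / 2"
      unfolding M_def by (rule strict[OF mem \<open>Y \<noteq> Z\<close>])
    ultimately show False by simp
  qed
  with min have "\<exists>!X. is_arg_min F (\<lambda>X. X \<in> compact_convex_sets) X" by blast
  then show ?thesis unfolding F_def .
qed

end
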